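(* For any constant $\epsilon>0$, HERALD* with the linear score function preserves $\frac{\epsilon l}{2}$-differential privacy, where $l$ is the number of task subsets. That is, let $M$ be the randomized map that sends a bid profile $\overrightarrow{b}=(b_1,\dots,b_m)\in[b_{\min},b_{\max}]^m$ to the task-worker matching result obtained by drawing, for each of the $l$ task subsets $\Gamma_1,\dots,\Gamma_l$ independently, a worker $i\in\mathcal{W}$ with probability $$\Pr(b_i)=\frac{\exp\left(-\frac{\epsilon b_i}{2(b_{\max}-b_{\min})}\right)}{\sum_{j\in\mathcal{W}}\exp\left(-\frac{\epsilon b_j}{2(b_{\max}-b_{\min})}\right)}.$$ Then for any two bid profiles $\overrightarrow{b},\overrightarrow{b}'$ differing in only one bid and any set $\mathcal{O}$ of matching results, $$\Pr[M(\overrightarrow{b})\in\mathcal{O}]\le \exp\left(\frac{\epsilon l}{2}\right)\Pr[M(\overrightarrow{b}')\in\mathcal{O}].$$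
   Context: $\mathcal{W}=\{1,\dots,m\}$ is the set of workers; worker $i$ submits a bid $b_i\in[b_{\min},b_{\max}]$, where $b_{\min}=1$ and $b_{\max}>b_{\min}$ is a constant. $\mathcal{Y}=\{\Gamma_1,\dots,\Gamma_l\}$ is a family of $l$ task subsets. The matching phase of the mechanism HERALD* assigns to each task subset one worker; a worker may be assigned several subsets. A matching result is the record of which worker is matched with each of $\Gamma_1,\dots,\Gamma_l$. The linear score function is $f_{lin}(x)=-x$; inserted (normalized by $b_{\max}$, with sensitivity $\Delta u=(b_{\max}-b_{\min})/b_{\max}$) in the exponential mechanism, which selects with probability proportional to $\exp(\epsilon u/(2\Delta u))$, it gives the displayed matching probabilities. A randomized mechanism $M$ preserves $\epsilon'$-differential privacy if for any two inputs $A,B$ differing in a single entry and any set $\mathcal{O}$ of outputs, $\Pr[M(A)\in\mathcal{O}]\le e^{\epsilon'}\Pr[M(B)\in\mathcal{O}]$. *)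

theory Defs
  imports "HOL-Probability.Probability"
begin

text \<open>Privacy is relative to a set of admissible inputs and a neighbouring relation on it.\<close>

definition differentially_private ::
  "real \<Rightarrow> 'a set \<Rightarrow> ('a \<Rightarrow> 'a \<Rightarrow> bool) \<Rightarrow> ('a \<Rightarrow> 'b pmf) \<Rightarrow> bool" where
  "differentially_private \<epsilon> D nb M \<longleftrightarrow>
     (\<forall>A\<in>D. \<forall>B\<in>D. nb A B \<longrightarrow>
       (\<forall>\<O>. measure_pmf.prob (M A) \<O> \<le> exp \<epsilon> * measure_pmf.prob (M B) \<O>))"

definition workers :: "nat \<Rightarrow> nat set" where
  "workers m = {1..m}"

definition b_min :: real where
  "b_min = 1"

definition bid_profiles :: "nat \<Rightarrow> real \<Rightarrow> (nat \<Rightarrow> real) set" where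
  "bid_profiles m b_max = workers m \<rightarrow>\<^sub>E {b_min..b_max}"

definition differ_in_one_bid :: "nat \<Rightarrow> (nat \<Rightarrow> real) \<Rightarrow> (nat \<Rightarrow> real) \<Rightarrow> bool" where
  "differ_in_one_bid m b b' \<longleftrightarrow> (\<exists>!i. i \<in> workers m \<and> b i \<noteq> b' i)"

definition match_prob :: "nat \<Rightarrow> real \<Rightarrow> real \<Rightarrow> (nat \<Rightarrow> real) \<Rightarrow> nat \<Rightarrow> real" where
  "match_prob m b_max \<epsilon> b i =
     exp (- (\<epsilon> * b i / (2 * (b_max - b_min)))) /
     (\<Sum>j\<in>workers m. exp (- (\<epsilon> * b j / (2 * (b_max - b_min)))))"

text \<open>The formula above is the exponential mechanism with the linear score function.\<close>

definition exp_mech_prob :: "'r set \<Rightarrow> ('r \<Rightarrow> real) \<Rightarrow> real \<Rightarrow> real \<Rightarrow> 'r \<Rightarrow> real" where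
  "exp_mech_prob R u \<Delta>u \<epsilon> r =
     exp (\<epsilon> * u r / (2 * \<Delta>u)) / (\<Sum>s\<in>R. exp (\<epsilon> * u s / (2 * \<Delta>u)))"

definition f_lin :: "real \<Rightarrow> real" where
  "f_lin x = - x"

lemma match_prob_eq_exp_mech_prob:
  assumes "b_max > b_min"
  shows "match_prob m b_max \<epsilon> b =
    exp_mech_prob (workers m) (\<lambda>i. f_lin (b i) / b_max) ((b_max - b_min) / b_max) \<epsilon>"
proof -
  have "b_max \<noteq> 0" "b_max - b_min \<noteq> 0"
    using assms by (auto simp: b_min_def)
  then have "\<epsilon> * (f_lin x / b_max) / (2 * ((b_max - b_min) / b_max))
      = - (\<epsilon> * x / (2 * (b_max - b_min)))" for x
    by (simp add: f_lin_def field_simps)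
  then show ?thesis
    by (simp add: fun_eq_iff match_prob_def exp_mech_prob_def)
qed

text \<open>
  \<open>embed_pmf\<close> is only meaningful for a probability mass function; this is the case
  whenever there is at least one worker, see \<open>pmf_worker_pmf\<close> below.
\<close>

definition worker_pmf :: "nat \<Rightarrow> real \<Rightarrow> real \<Rightarrow> (nat \<Rightarrow> real) \<Rightarrow> nat pmf" where
  "worker_pmf m b_max \<epsilon> b =
     embed_pmf (\<lambda>i. if i \<in> workers m then match_prob m b_max \<epsilon> b i else 0)"

lemma pmf_worker_pmf:
  assumes "m \<ge> 1"
  shows "pmf (worker_pmf m b_max \<epsilon> b) i =
    (if i \<in> workers m then match_prob m b_max \<epsilon> b i else 0)"
  unfolding worker_pmf_def
proof (rule pmf_embed_pmf)
  let ?p = "\<lambda>i. if i \<in> workers m then match_prob m b_max \<epsilon> b i else 0"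
  show nonneg: "?p i \<ge> 0" for i
    by (auto simp: match_prob_def intro!: divide_nonneg_nonneg sum_nonneg)
  have fin: "finite (workers m)" and ne: "workers m \<noteq> {}"
    using assms by (auto simp: workers_def)
  have "(\<Sum>j\<in>workers m. exp (- (\<epsilon> * b j / (2 * (b_max - b_min))))) > 0"
    by (rule sum_pos[OF fin ne]) simp
  then have total: "(\<Sum>i\<in>workers m. ?p i) = 1"
    by (simp add: match_prob_def sum_divide_distrib[symmetric])
  have "(\<integral>\<^sup>+i. ennreal (?p i) \<partial>count_space UNIV) = (\<Sum>i\<in>workers m. ennreal (?p i))"
    by (subst nn_integral_count_space'[OF fin]) auto
  also have "\<dots> = ennreal (\<Sum>i\<in>workers m. ?p i)"
    using nonneg by (intro sum_ennreal)
  finally show "(\<integral>\<^sup>+i. ennreal (?p i) \<partial>count_space UNIV) = 1"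
    by (simp only: total ennreal_1)
qed

text \<open>
  A matching result maps the index \<open>k \<in> {1..l}\<close> of a task subset to its worker (and is
  \<open>undefined\<close> outside \<open>{1..l}\<close>); \<open>Pi_pmf\<close> makes the \<open>l\<close> draws independent.
\<close>

definition herald_star_lin ::
  "nat \<Rightarrow> nat \<Rightarrow> real \<Rightarrow> real \<Rightarrow> (nat \<Rightarrow> real) \<Rightarrow> (nat \<Rightarrow> nat) pmf" where
  "herald_star_lin m l b_max \<epsilon> b = Pi_pmf {1..l} undefined (\<lambda>_. worker_pmf m b_max \<epsilon> b)"

end

theory Submission
  imports Defs
begin

text \<open>
  Changing one bid multiplies one weight \<open>exp (- \<epsilon> b / (2 (b_max - b_min)))\<close> by a factor in
  \<open>[exp (- \<epsilon> / 2), exp (\<epsilon> / 2)]\<close>. This changes a normalized weight \<open>w i / \<Sum> w\<close> by at most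
  the factor \<open>exp (\<epsilon> / 2)\<close>, and not by its square: the changed weight occurs in its own
  denominator, and numerator and denominator of that quotient move in the same direction.
  The \<open>l\<close> independent draws multiply the factor \<open>l\<close> times.
\<close>

text \<open>For discrete distributions the probability of an event is the sum of its point masses,
  so a privacy bound on all events follows from one on single outcomes.\<close>

lemma prob_le_if_pmf_le:
  assumes "\<And>x. pmf p x \<le> c * pmf q x"
  shows "measure_pmf.prob p A \<le> c * measure_pmf.prob q A"
proof -
  have "infsetsum (pmf p) A \<le> infsetsum (\<lambda>x. c * pmf q x) A"
    using assms by (intro infsetsum_mono abs_summable_on_cmult_right pmf_abs_summable)
  also have "\<dots> = c * infsetsum (pmf q) A"
    by (intro infsetsum_cmult_right pmf_abs_summable)
  finally show ?thesis
    by (simp add: measure_pmf_conv_infsetsum)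
qed

text \<open>The mass of an independent family is a product over \<open>I\<close>, so each coordinate
  contributes one factor \<open>c\<close>.\<close>

lemma pmf_Pi_le:
  assumes "finite I" and "\<And>i x. i \<in> I \<Longrightarrow> pmf (p i) x \<le> c * pmf (q i) x"
  shows "pmf (Pi_pmf I d p) f \<le> c ^ card I * pmf (Pi_pmf I d q) f"
proof (cases "\<forall>i. i \<notin> I \<longrightarrow> f i = d")
  case True
  have "(\<Prod>i\<in>I. pmf (p i) (f i)) \<le> (\<Prod>i\<in>I. c * pmf (q i) (f i))"
    using assms(2) by (intro prod_mono) auto
  also have "\<dots> = c ^ card I * (\<Prod>i\<in>I. pmf (q i) (f i))"
    by (simp add: prod.distrib)
  finally show ?thesis
    using True by (simp add: pmf_Pi assms(1))
next
  case False
  \<comment> \<open>Here \<open>f\<close> departs from the default \<open>d\<close> outside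
    \<open>I\<close>, so both masses are 0.\<close>
  then show ?thesis
    by (subst (1 2) pmf_Pi) (simp_all only: assms(1) if_False mult_zero_right)
qed

lemma normalized_weight_le:
  fixes w w' :: "'a \<Rightarrow> real"
  assumes fin: "finite R" and k: "k \<in> R" and i: "i \<in> R"
    and pos: "\<And>j. j \<in> R \<Longrightarrow> w j > 0" "\<And>j. j \<in> R \<Longrightarrow> w' j > 0"
    and same: "\<And>j. j \<in> R \<Longrightarrow> j \<noteq> k \<Longrightarrow> w j = w' j"
    and le: "w k \<le> c * w' k" "w' k \<le> c * w k" and c: "c \<ge> 1"
  shows "w i / sum w R \<le> c * (w' i / sum w' R)"
proof -
  define S where "S = sum w (R - {k})"
  have S: "S \<ge> 0"
    unfolding S_def by (intro sum_nonneg) (use pos(1) in \<open>auto intro: less_imp_le\<close>)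
  have w: "sum w R = w k + S"
    by (simp add: S_def sum.remove[OF fin k])
  have w': "sum w' R = w' k + S"
    unfolding S_def sum.remove[OF fin k] by (simp add: same)
  have cS: "S \<le> c * S"
    using mult_right_mono[OF c S] by simp
  \<comment> \<open>This is the claim with denominators cleared. Expanded, each product on the left
    needs a single use of a bound with factor \<open>c\<close>, so no \<open>c * c\<close>
    arises.\<close>
  have "w i * (w' k + S) \<le> c * w' i * (w k + S)"
  proof (cases "i = k")
    case True
    \<comment> \<open>The product \<open>w k * w' k\<close> occurs on both sides, so only
      \<open>c \<ge> 1\<close> is required for it; the term with \<open>S\<close> uses the bound on
      \<open>w k\<close>.\<close>
    have "1 * (w k * w' k) \<le> c * (w k * w' k)"
      using c pos k by (intro mult_right_mono) (auto intro: less_imp_le)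
    moreover have "w k * S \<le> c * w' k * S"
      using le(1) S by (rule mult_right_mono)
    ultimately show ?thesis
      using True by (simp add: algebra_simps)
  next
    case False
    have "w i * (w' k + S) \<le> w i * (c * w k + c * S)"
      using le(2) cS pos(1)[OF i] by (intro mult_left_mono) auto
    then show ?thesis
      using same[OF i False] by (simp add: algebra_simps)
  qed
  moreover have "w k + S > 0" "w' k + S > 0"
    using pos[OF k] S by auto
  ultimately show ?thesis
    by (simp add: w w' field_simps)
qed

lemma match_prob_le:
  assumes "b_max > b_min" and "\<epsilon> > 0"
    and b: "b \<in> bid_profiles m b_max" and b': "b' \<in> bid_profiles m b_max"
    and nb: "differ_in_one_bid m b b'" and i: "i \<in> workers m"
  shows "match_prob m b_max \<epsilon> b i \<le> exp (\<epsilon> / 2) * match_prob m b_max \<epsilon> b' i"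
proof -
  define w where "w x = exp (- (\<epsilon> * x / (2 * (b_max - b_min))))" for x
  have w_le: "w x \<le> exp (\<epsilon> / 2) * w y" if "x \<in> {b_min..b_max}" "y \<in> {b_min..b_max}" for x y
  proof -
    \<comment> \<open>Two bids differ by at most the width of the bid interval. The exponent divides
      by twice this width, which leaves \<open>\<epsilon> / 2\<close>.\<close>
    have "\<epsilon> * (y - x) \<le> \<epsilon> * (b_max - b_min)"
      using that assms(2) by (intro mult_left_mono) auto
    then have "\<epsilon> * (y - x) / (2 * (b_max - b_min)) \<le> \<epsilon> / 2"
      using assms(1) by (simp add: pos_divide_le_eq algebra_simps)
    then have "- (\<epsilon> * x / (2 * (b_max - b_min)))
        \<le> \<epsilon> / 2 + - (\<epsilon> * y / (2 * (b_max - b_min)))"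
      unfolding right_diff_distrib[of \<epsilon>] diff_divide_distrib by linarith
    then show ?thesis
      by (simp add: w_def flip: exp_add)
  qed
  obtain k where k: "k \<in> workers m" and same: "\<And>j. j \<in> workers m \<Longrightarrow> j \<noteq> k \<Longrightarrow> b j = b' j"
    using nb unfolding differ_in_one_bid_def by blast
  have bk: "b k \<in> {b_min..b_max}" "b' k \<in> {b_min..b_max}"
    using b b' k unfolding bid_profiles_def by (blast dest: PiE_mem)+
  have "w (b i) / (\<Sum>j\<in>workers m. w (b j))
      \<le> exp (\<epsilon> / 2) * (w (b' i) / (\<Sum>j\<in>workers m. w (b' j)))"
  proof (rule normalized_weight_le[OF _ k i])
    show "finite (workers m)"
      by (simp add: workers_def)
    show "w (b k) \<le> exp (\<epsilon> / 2) * w (b' k)" "w (b' k) \<le> exp (\<epsilon> / 2) * w (b k)"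
      using bk by (auto intro: w_le)
  qed (use same assms(2) in \<open>auto simp: w_def\<close>)
  then show ?thesis
    by (simp add: match_prob_def w_def)
qed

theorem theorem3:
  fixes m l :: nat and b_max \<epsilon> :: real
  assumes "b_max > b_min" and "\<epsilon> > 0"
  shows "differentially_private (\<epsilon> * real l / 2) (bid_profiles m b_max) (differ_in_one_bid m)
           (herald_star_lin m l b_max \<epsilon>)"
  unfolding differentially_private_def
proof (intro ballI impI allI)
  fix b b' \<O>
  assume b: "b \<in> bid_profiles m b_max" and b': "b' \<in> bid_profiles m b_max"
    and nb: "differ_in_one_bid m b b'"
  have "m \<ge> 1"
    using nb by (auto simp: differ_in_one_bid_def workers_def)
  then have "pmf (worker_pmf m b_max \<epsilon> b) i \<le> exp (\<epsilon> / 2) * pmf (worker_pmf m b_max \<epsilon> b') i" for i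
    using match_prob_le[OF assms b b' nb] by (simp add: pmf_worker_pmf)
  then have "pmf (herald_star_lin m l b_max \<epsilon> b) f
      \<le> exp (\<epsilon> / 2) ^ card {1..l} * pmf (herald_star_lin m l b_max \<epsilon> b') f" for f
    unfolding herald_star_lin_def by (intro pmf_Pi_le) auto
  moreover have "exp (\<epsilon> / 2) ^ card {1..l} = exp (\<epsilon> * real l / 2)"
    by (simp add: exp_of_nat_mult[symmetric] mult.commute)
  ultimately show "measure_pmf.prob (herald_star_lin m l b_max \<epsilon> b) \<O>
      \<le> exp (\<epsilon> * real l / 2) * measure_pmf.prob (herald_star_lin m l b_max \<epsilon> b') \<O>"
    by (intro prob_le_if_pmf_le) simp
qed

end
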